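(* For every $n\in\mathbb{N}$ with $n\ge 2$, every $B_1\in\mathfrak{B}(\sigma_n)$ and every $B_2\in\overline{\mathrm{conv}}\,(\mathrm{ext}\,\mathfrak{B})$, where the closure of the convex hull is taken in the norm topology of $\ell_\infty^*$, one has $\|B_1-B_2\|_{\ell_\infty^*}=2$.
   Context: $\mathbb{N}=\{1,2,3,\ldots\}$, and $\ell_\infty$ is the space of all bounded (real) sequences $x=(x_1,x_2,\ldots)$ with the norm $\|x\|_{\ell_\infty}=\sup_{n}|x_n|$ and the usual coordinatewise partial order; $\ell_\infty^*$ is its dual with the dual norm. A linear functional $B\in\ell_\infty^*$ is a Banach limit if (1) $Bx\ge 0$ for every $x\ge 0$; (2) $B(\mathbf{1})=1$, where $\mathbf{1}=(1,1,\ldots)$; (3) $B(Tx)=B(x)$ for every $x\in\ell_\infty$, where $T(x_1,x_2,\ldots)=(0,x_1,x_2,\ldots)$. The set of all Banach limits is denoted $\mathfrak{B}$; it is a convex set, and $\mathrm{ext}\,\mathfrak{B}$ denotes the set of its extreme points. For $n\in\mathbb{N}$ the dilation operator is $\sigma_n(x_1,x_2,\ldots)=(\underbrace{x_1,\ldots,x_1}_{n},\underbrace{x_2,\ldots,x_2}_{n},\ldots)$ on $\ell_\infty$, and $\mathfrak{B}(\sigma_n)=\{B\in\mathfrak{B}: B(\sigma_n x)=B(x)\text{ for all }x\in\ell_\infty\}$. *)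

theory Defs
  imports "HOL-Analysis.Analysis"
begin

(* Since nat carries the discrete topology, bounded continuous functions on nat are
   exactly the bounded real sequences, with the supremum norm.  Indices start at 0:
   the entry x_k of a sequence (x_1, x_2, ...) is "apply_bcontfun x (k - 1)". *)
type_synonym linf = "nat \<Rightarrow>\<^sub>C real"

type_synonym linf_dual = "linf \<Rightarrow>\<^sub>L real"

context includes bcontfun.lifting
begin

lift_definition shift :: "linf \<Rightarrow> linf"
  is "\<lambda>x i. case i of 0 \<Rightarrow> 0 | Suc j \<Rightarrow> x j"
proof -
  fix x :: "nat \<Rightarrow> real"
  assume "x \<in> bcontfun"
  then have "bounded (range x)"
    by (simp add: bcontfun_def)
  then have "bounded (insert 0 (range x))"
    by simp
  moreover have "range (\<lambda>i. case i of 0 \<Rightarrow> 0 | Suc j \<Rightarrow> x j) \<subseteq> insert 0 (range x)"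
    by (auto split: nat.splits)
  ultimately have "bounded (range (\<lambda>i. case i of 0 \<Rightarrow> 0 | Suc j \<Rightarrow> x j))"
    by (rule bounded_subset)
  then show "(\<lambda>i. case i of 0 \<Rightarrow> 0 | Suc j \<Rightarrow> x j) \<in> bcontfun"
    by (simp add: bcontfun_def)
qed

(* With 0-based indices, repeating every entry n times puts the entry with index
   "i div n" at index i (for n > 0). *)
lift_definition dilation :: "nat \<Rightarrow> linf \<Rightarrow> linf"
  is "\<lambda>n x i. x (i div n)"
proof -
  fix n :: nat and x :: "nat \<Rightarrow> real"
  assume "x \<in> bcontfun"
  then have "bounded (range x)"
    by (simp add: bcontfun_def)
  moreover have "range (\<lambda>i. x (i div n)) \<subseteq> range x"
    by auto
  ultimately have "bounded (range (\<lambda>i. x (i div n)))"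
    by (rule bounded_subset)
  then show "(\<lambda>i. x (i div n)) \<in> bcontfun"
    by (simp add: bcontfun_def)
qed

end

definition banach_limits :: "linf_dual set" where
  "banach_limits = {B.
     (\<forall>x. (\<forall>i. 0 \<le> apply_bcontfun x i) \<longrightarrow> 0 \<le> blinfun_apply B x) \<and>
     blinfun_apply B (const_bcontfun 1) = 1 \<and>
     (\<forall>x. blinfun_apply B (shift x) = blinfun_apply B x)}"

definition dilation_invariant_banach_limits :: "nat \<Rightarrow> linf_dual set" where
  "dilation_invariant_banach_limits n =
     {B \<in> banach_limits. \<forall>x. blinfun_apply B (dilation n x) = blinfun_apply B x}"

end

theory Submission
  imports Defs
begin

text \<open>
  Two positive functionals of mass one are at distance 2 as soon as there are sequences with
  entries in \<open>[0, 1]\<close> at which one functional is arbitrarily close to 0 and, simultaneously, the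
  other is arbitrarily close to 1. A dilation-invariant
  Banach limit \<open>A\<close> and an extreme Banach limit \<open>B\<close> are separated in this way by sequences that
  vary slowly, on a logarithmic scale.

  The idea is to look at the points \<open>z\<^sub>i = cis (\<theta> ln (i + 1))\<close> of the unit circle. Since
  \<open>z\<^bsub>i+1\<^esub> - z\<^sub>i\<close> tends to 0, the shift does not move them asymptotically, and multiplication of the
  argument by a nonnegative slowly varying weight maps a Banach limit to a shift-invariant functional.
  Extremality of \<open>B\<close> makes every such weighted functional a multiple of \<open>B\<close>, so \<open>B\<close> is
  multiplicative on slowly varying sequences: under \<open>B\<close> they have variance zero
  (\<open>extreme_banach_limit_variance_zero\<close>), and \<open>B\<close> sees all the \<open>z\<^sub>i\<close> at a single point \<open>w\<close>.

  Dilation by \<open>n\<close>, on the contrary, acts on the points as the rotation by the angle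
  \<open>- \<theta> ln n\<close>. Choosing \<open>\<theta>\<close> such that this rotation has order \<open>N\<close>, the functional \<open>A\<close> has to spread
  its mass evenly over \<open>N\<close> rotated copies of any small arc. The copies are disjoint, so \<open>A\<close> gives
  mass at most \<open>1 / N\<close> to the arc around \<open>w\<close> that carries the full mass of \<open>B\<close>
  (\<open>dilation_invariant_separated_from_extreme\<close>).

  Separation from \<open>A\<close> is inherited by convex combinations, because the maximum of two separating
  sequences separates as well (\<open>convex_separated_from\<close>). Hence the convex hull of the extreme
  points lies on the sphere of radius 2 around \<open>A\<close>, and since this sphere is closed, so does the
  closure of the hull.
\<close>

section \<open>Banach limits as functionals on bounded sequences\<close>

text \<open>
  Functionals are evaluated on plain functions, so that pointwise operations (products, maxima,
  reindexing) can be written directly; the value is meaningful for bounded sequences.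
\<close>

definition seq_apply :: "linf_dual \<Rightarrow> (nat \<Rightarrow> real) \<Rightarrow> real" where
  "seq_apply B h = blinfun_apply B (Bcontfun h)"

lemma apply_Bcontfun:
  fixes h :: "nat \<Rightarrow> real"
  assumes "bounded (range h)"
  shows "apply_bcontfun (Bcontfun h) = h"
  using assms by (intro Bcontfun_inverse) (simp add: bcontfun_def)

lemma bounded_range_apply_bcontfun: "bounded (range (apply_bcontfun (x :: linf)))"
  using apply_bcontfun[of x] by (simp add: bcontfun_def)

lemma seq_apply_apply_bcontfun: "seq_apply B (apply_bcontfun x) = blinfun_apply B x"
  by (simp add: seq_apply_def apply_bcontfun_inverse)

lemma bounded_range_mult:
  fixes f g :: "nat \<Rightarrow> real"
  assumes "bounded (range f)" and "bounded (range g)"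
  shows "bounded (range (\<lambda>i. f i * g i))"
proof -
  obtain K L where "\<And>i. \<bar>f i\<bar> \<le> K" "\<And>i. \<bar>g i\<bar> \<le> L"
    using assms by (auto simp: bounded_iff)
  then have "\<bar>f i * g i\<bar> \<le> K * L" for i
    unfolding abs_mult by (intro mult_mono) (auto intro: order_trans[OF abs_ge_zero])
  then show ?thesis
    by (auto simp: bounded_iff)
qed

lemma seq_apply_add:
  assumes "bounded (range f)" "bounded (range g)"
  shows "seq_apply B (\<lambda>i. f i + g i) = seq_apply B f + seq_apply B g"
proof -
  have "Bcontfun (\<lambda>i. f i + g i) = Bcontfun f + Bcontfun g"
    using assms by (intro bcontfun_eqI) (simp add: apply_Bcontfun bounded_plus_comp)
  then show ?thesis
    by (simp add: seq_apply_def blinfun.add_right)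
qed

lemma seq_apply_diff:
  assumes "bounded (range f)" "bounded (range g)"
  shows "seq_apply B (\<lambda>i. f i - g i) = seq_apply B f - seq_apply B g"
proof -
  have "Bcontfun (\<lambda>i. f i - g i) = Bcontfun f - Bcontfun g"
    using assms by (intro bcontfun_eqI) (simp add: apply_Bcontfun bounded_minus_comp)
  then show ?thesis
    by (simp add: seq_apply_def blinfun.diff_right)
qed

lemma seq_apply_cmult:
  assumes "bounded (range f)"
  shows "seq_apply B (\<lambda>i. c * f i) = c * seq_apply B f"
proof -
  have "bounded (range (\<lambda>i. c * f i))"
    using assms by (intro bounded_range_mult) auto
  then have "Bcontfun (\<lambda>i. c * f i) = c *\<^sub>R Bcontfun f"
    using assms by (intro bcontfun_eqI) (simp add: apply_Bcontfun)
  then show ?thesis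
    by (simp add: seq_apply_def blinfun.scaleR_right)
qed

lemma bounded_range_sum:
  fixes f :: "'k \<Rightarrow> nat \<Rightarrow> real"
  assumes "\<And>k. bounded (range (f k))"
  shows "bounded (range (\<lambda>i. \<Sum>k\<in>A. f k i))"
  using assms by (induction A rule: infinite_finite_induct) (auto intro: bounded_plus_comp)

lemma seq_apply_sum:
  assumes "finite A" "\<And>k. bounded (range (f k))"
  shows "seq_apply B (\<lambda>i. \<Sum>k\<in>A. f k i) = (\<Sum>k\<in>A. seq_apply B (f k))"
  using assms
proof (induction A rule: finite_induct)
  case empty
  show ?case
    using seq_apply_cmult[of "\<lambda>_. 0" B 0] by simp
next
  case (insert k A)
  then show ?case
    by (simp add: seq_apply_add bounded_range_sum)
qed

lemma seq_apply_const:
  assumes "B \<in> banach_limits"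
  shows "seq_apply B (\<lambda>_. c) = c"
proof -
  have "seq_apply B (\<lambda>_. 1) = 1"
    using assms by (simp add: banach_limits_def seq_apply_def const_bcontfun_def map_fun_def comp_def)
  then show ?thesis
    using seq_apply_cmult[of "\<lambda>_. 1" B c] by simp
qed

lemma seq_apply_nonneg:
  assumes "B \<in> banach_limits" "bounded (range f)" "\<And>i. 0 \<le> f i"
  shows "0 \<le> seq_apply B f"
  using assms by (simp add: banach_limits_def seq_apply_def apply_Bcontfun)

lemma seq_apply_mono:
  assumes "B \<in> banach_limits" "bounded (range f)" "bounded (range g)" "\<And>i. f i \<le> g i"
  shows "seq_apply B f \<le> seq_apply B g"
  using seq_apply_nonneg[OF assms(1), of "\<lambda>i. g i - f i"] assms
  by (simp add: seq_apply_diff bounded_minus_comp)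

lemma norm_banach_limit_le:
  assumes "B \<in> banach_limits"
  shows "norm B \<le> 1"
proof (rule norm_blinfun_bound)
  fix x :: linf
  have x: "\<bar>apply_bcontfun x i\<bar> \<le> norm x" for i
    using norm_bounded[of x i] by simp
  have "seq_apply B (apply_bcontfun x) \<le> seq_apply B (\<lambda>_. norm x)"
    using x by (intro seq_apply_mono assms bounded_range_apply_bcontfun) (auto simp: abs_le_iff)
  moreover have "seq_apply B (\<lambda>_. - norm x) \<le> seq_apply B (apply_bcontfun x)"
    using x by (intro seq_apply_mono assms bounded_range_apply_bcontfun)
      (auto simp: abs_le_iff minus_le_iff)
  ultimately show "norm (blinfun_apply B x) \<le> 1 * norm x"
    using assms by (simp add: seq_apply_const seq_apply_apply_bcontfun)
qed simp

lemma seq_apply_shift: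
  assumes "B \<in> banach_limits" "bounded (range f)"
  shows "seq_apply B (\<lambda>i. case i of 0 \<Rightarrow> 0 | Suc j \<Rightarrow> f j) = seq_apply B f"
proof -
  have "(\<lambda>i. case i of 0 \<Rightarrow> 0 | Suc j \<Rightarrow> f j) = apply_bcontfun (shift (Bcontfun f))"
    by (rule ext) (simp add: shift.rep_eq apply_Bcontfun assms split: nat.split)
  then have "seq_apply B (\<lambda>i. case i of 0 \<Rightarrow> 0 | Suc j \<Rightarrow> f j) = blinfun_apply B (shift (Bcontfun f))"
    by (simp only: seq_apply_apply_bcontfun)
  then show ?thesis
    using assms by (simp add: banach_limits_def seq_apply_def)
qed

lemma bounded_range_indicator: "bounded (range (\<lambda>i. of_bool (i < m) :: real))"
  by (auto simp: bounded_iff intro!: exI[of _ 1])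

text \<open>
  The indicator of the first index is the difference between the constant 1 and its shift, so a
  Banach limit vanishes on it; longer segments arise from it by shifting.
\<close>

lemma seq_apply_initial_segment:
  assumes "B \<in> banach_limits"
  shows "seq_apply B (\<lambda>i. of_bool (i < m)) = 0"
proof (induction m)
  case 0
  show ?case
    using seq_apply_const[OF assms, of 0] by simp
next
  case (Suc m)
  have shifted: "(\<lambda>i. of_bool (i < Suc m) :: real) =
      (\<lambda>i. of_bool (i < Suc 0) + (case i of 0 \<Rightarrow> 0 | Suc j \<Rightarrow> of_bool (j < m)))"
    by (auto split: nat.splits)
  have first: "(\<lambda>i. of_bool (i < Suc 0) :: real) =
      (\<lambda>i. 1 - (case i of 0 \<Rightarrow> 0 | Suc j \<Rightarrow> 1))"
    by (auto split: nat.splits)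
  have bdd: "bounded (range (\<lambda>i. case i of 0 \<Rightarrow> 0 | Suc j \<Rightarrow> (of_bool (j < k) :: real)))"
      "bounded (range (\<lambda>i. case i of 0 \<Rightarrow> 0 | Suc j \<Rightarrow> (1 :: real)))" for k
    by (auto simp: bounded_iff split: nat.splits intro!: exI[of _ 1])
  have "seq_apply B (\<lambda>i. of_bool (i < Suc 0)) = 0"
    unfolding first using assms bdd
    by (simp add: seq_apply_diff seq_apply_shift seq_apply_const)
  then show ?case
    using Suc seq_apply_add[OF bounded_range_indicator bdd(1), of B "Suc 0" m]
      seq_apply_shift[OF assms bounded_range_indicator, of m]
    unfolding shifted by simp
qed

text \<open>
  A null sequence is dominated, for every \<open>e > 0\<close>, by \<open>e\<close> plus a multiple of the indicator of an
  initial segment.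
\<close>

lemma seq_apply_null:
  assumes B: "B \<in> banach_limits" and f: "f \<longlonglongrightarrow> 0"
  shows "seq_apply B f = 0"
proof -
  have bdd: "bounded (range f)"
    using f by (simp add: convergent_imp_bounded)
  then obtain K where K: "\<And>i. \<bar>f i\<bar> \<le> K"
    by (auto simp: bounded_iff)
  have "\<bar>seq_apply B f\<bar> \<le> e" if "e > 0" for e
  proof -
    obtain m where m: "\<And>i. i \<ge> m \<Longrightarrow> \<bar>f i\<bar> < e"
      using LIMSEQ_D[OF f \<open>e > 0\<close>] by auto
    define h where "h = (\<lambda>i. e + K * of_bool (i < m))"
    have bddK: "bounded (range (\<lambda>i. K * of_bool (i < m) :: real))"
      by (intro bounded_range_mult bounded_range_indicator) auto
    then have bddh: "bounded (range h)"
      unfolding h_def by (intro bounded_plus_comp) auto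
    have h: "seq_apply B h = e"
      unfolding h_def using bddK B bounded_range_indicator
      seq_apply_cmult[OF bounded_range_indicator, of B K m]
      by (simp add: seq_apply_add seq_apply_const seq_apply_initial_segment)
    have le: "\<bar>f i\<bar> \<le> h i" for i
      using K[of i] m[of i] \<open>e > 0\<close> by (cases "i < m") (auto simp: h_def)
    have "seq_apply B f \<le> e"
      unfolding h[symmetric] using le by (intro seq_apply_mono B bdd bddh) (simp add: abs_le_iff)
    moreover have "seq_apply B (\<lambda>i. (-1) * h i) \<le> seq_apply B f"
      using le bddh
      by (intro seq_apply_mono B bdd bounded_range_mult) (auto simp: abs_le_iff minus_le_iff)
    ultimately show ?thesis
      using seq_apply_cmult[OF bddh, of B "-1"] h by simp
  qed
  then have "\<bar>seq_apply B f\<bar> \<le> 0"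
    by (rule field_le_epsilon) simp
  then show ?thesis
    by simp
qed

lemma seq_apply_cong_null:
  assumes "B \<in> banach_limits" "bounded (range f)" "bounded (range g)"
    and "(\<lambda>i. f i - g i) \<longlonglongrightarrow> 0"
  shows "seq_apply B f = seq_apply B g"
  using seq_apply_null[OF assms(1,4)] assms(2,3) by (simp add: seq_apply_diff)

lemma bounded_range_Suc:
  fixes f :: "nat \<Rightarrow> real"
  shows "bounded (range f) \<Longrightarrow> bounded (range (\<lambda>i. f (Suc i)))"
  by (erule bounded_subset) auto

text \<open>
  Shifting left and then right changes a sequence at index 0 only, so invariance under the right
  shift entails invariance under the left shift, which involves no case distinction.
\<close>

lemma seq_apply_Suc:
  assumes B: "B \<in> banach_limits" and f: "bounded (range f)"
  shows "seq_apply B (\<lambda>i. f (Suc i)) = seq_apply B f"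
proof -
  define g where "g = (\<lambda>i. case i of 0 \<Rightarrow> 0 | Suc j \<Rightarrow> f (Suc j))"
  have "range g \<subseteq> insert 0 (range f)"
    by (auto simp: g_def split: nat.splits)
  with f have bddg: "bounded (range g)"
    by (metis bounded_insert bounded_subset)
  have "(\<lambda>i. g i - f i) \<longlonglongrightarrow> 0"
    by (rule LIMSEQ_offset[of _ 1]) (simp add: g_def)
  then have "seq_apply B g = seq_apply B f"
    by (rule seq_apply_cong_null[OF B bddg f])
  then show ?thesis
    using seq_apply_shift[OF B bounded_range_Suc[OF f]] by (simp add: g_def)
qed

lemma seq_apply_dilation:
  assumes B: "B \<in> dilation_invariant_banach_limits n" and f: "bounded (range f)"
  shows "seq_apply B (\<lambda>i. f (i div n)) = seq_apply B f"
proof -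
  have "(\<lambda>i. f (i div n)) = apply_bcontfun (dilation n (Bcontfun f))"
    by (rule ext) (simp add: dilation.rep_eq apply_Bcontfun f)
  then have "seq_apply B (\<lambda>i. f (i div n)) = blinfun_apply B (dilation n (Bcontfun f))"
    by (simp only: seq_apply_apply_bcontfun)
  then show ?thesis
    using B by (simp add: dilation_invariant_banach_limits_def seq_apply_def)
qed

section \<open>Extreme Banach limits on slowly varying sequences\<close>

definition weighted :: "linf_dual \<Rightarrow> (nat \<Rightarrow> real) \<Rightarrow> linf_dual" where
  "weighted B p = Blinfun (\<lambda>x. seq_apply B (\<lambda>i. p i * apply_bcontfun x i))"

lemma blinfun_apply_weighted:
  assumes p: "bounded (range p)"
  shows "blinfun_apply (weighted B p) x = seq_apply B (\<lambda>i. p i * apply_bcontfun x i)"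
proof -
  obtain K where K: "\<And>i. \<bar>p i\<bar> \<le> K"
    using p by (auto simp: bounded_iff)
  have bdd: "bounded (range (\<lambda>i. p i * apply_bcontfun x i))" for x
    using p bounded_range_apply_bcontfun by (rule bounded_range_mult)
  have "bounded_linear (\<lambda>x. seq_apply B (\<lambda>i. p i * apply_bcontfun x i))"
  proof (rule bounded_linear_intro[where K = "norm B * K"])
    fix x y :: linf and r :: real
    show "seq_apply B (\<lambda>i. p i * apply_bcontfun (x + y) i) =
        seq_apply B (\<lambda>i. p i * apply_bcontfun x i) + seq_apply B (\<lambda>i. p i * apply_bcontfun y i)"
      using seq_apply_add[OF bdd[of x] bdd[of y]] by (simp add: distrib_left)
    show "seq_apply B (\<lambda>i. p i * apply_bcontfun (r *\<^sub>R x) i) =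
        r *\<^sub>R seq_apply B (\<lambda>i. p i * apply_bcontfun x i)"
      using seq_apply_cmult[OF bdd[of x], of B r] by (simp add: mult.left_commute)
    have "norm (Bcontfun (\<lambda>i. p i * apply_bcontfun x i)) \<le> K * norm x"
    proof (rule norm_bound)
      fix i
      have "\<bar>p i * apply_bcontfun x i\<bar> \<le> K * norm x"
        unfolding abs_mult using K norm_bounded[of x i]
        by (intro mult_mono) (auto intro: order_trans[OF abs_ge_zero])
      then show "norm (apply_bcontfun (Bcontfun (\<lambda>i. p i * apply_bcontfun x i)) i) \<le> K * norm x"
        by (simp add: apply_Bcontfun[OF bdd])
    qed
    then show "norm (seq_apply B (\<lambda>i. p i * apply_bcontfun x i)) \<le> norm x * (norm B * K)"
      using order_trans[OF norm_blinfun mult_left_mono[OF _ norm_ge_zero],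
          of "Bcontfun (\<lambda>i. p i * apply_bcontfun x i)" "K * norm x" B]
      by (simp add: seq_apply_def ac_simps)
  qed
  then show ?thesis
    by (simp add: weighted_def bounded_linear_Blinfun_apply)
qed

definition slowly_varying :: "(nat \<Rightarrow> real) \<Rightarrow> bool" where
  "slowly_varying f \<longleftrightarrow> bounded (range f) \<and> (\<lambda>i. f (Suc i) - f i) \<longlonglongrightarrow> 0"

text \<open>
  A slowly varying weight commutes with the shift up to a null sequence; this makes the weighted
  functional shift-invariant again.
\<close>

lemma normalized_weighted_banach_limit:
  assumes B: "B \<in> banach_limits" and p: "slowly_varying p" "\<And>i. 0 \<le> p i"
    and pos: "seq_apply B p > 0"
  shows "weighted B p /\<^sub>R seq_apply B p \<in> banach_limits"
proof -
  have bddp: "bounded (range p)" and null: "(\<lambda>i. p (Suc i) - p i) \<longlonglongrightarrow> 0"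
    using p(1) by (auto simp: slowly_varying_def)
  have bdd: "bounded (range (\<lambda>i. p i * apply_bcontfun x i))" for x
    using bddp bounded_range_apply_bcontfun by (rule bounded_range_mult)
  have "seq_apply B (\<lambda>i. p i * apply_bcontfun (shift x) i) =
      seq_apply B (\<lambda>i. p i * apply_bcontfun x i)" for x
  proof -
    have "seq_apply B (\<lambda>i. p i * apply_bcontfun (shift x) i) =
        seq_apply B (\<lambda>i. p (Suc i) * apply_bcontfun x i)"
      using seq_apply_Suc[OF B bdd[of "shift x"]] by (simp add: shift.rep_eq)
    also have "\<dots> = seq_apply B (\<lambda>i. p i * apply_bcontfun x i)"
    proof (rule seq_apply_cong_null[OF B _ bdd])
      show "bounded (range (\<lambda>i. p (Suc i) * apply_bcontfun x i))"
        by (intro bounded_range_mult bounded_range_Suc bddp bounded_range_apply_bcontfun)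
      have "(\<lambda>i. (p (Suc i) - p i) * apply_bcontfun x i) \<longlonglongrightarrow> 0"
        using null bounded_range_apply_bcontfun[of x]
        by (intro lim_null_mult_right_bounded[where B = "norm x"])
          (auto intro!: always_eventually simp: norm_bounded simp flip: real_norm_def)
      then show "(\<lambda>i. p (Suc i) * apply_bcontfun x i - p i * apply_bcontfun x i) \<longlonglongrightarrow> 0"
        by (simp add: left_diff_distrib)
    qed
    finally show ?thesis .
  qed
  moreover have "0 \<le> seq_apply B (\<lambda>i. p i * apply_bcontfun x i)"
    if "\<forall>i. 0 \<le> apply_bcontfun x i" for x
    using that p(2) by (intro seq_apply_nonneg B bdd) auto
  ultimately show ?thesis
    using pos by (simp add: banach_limits_def blinfun_apply_weighted[OF bddp] blinfun.scaleR_left)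
qed

text \<open>
  With \<open>a\<close> the value of \<open>B\<close> at \<open>p\<close>, the splitting \<open>1 = p + (1 - p)\<close> writes \<open>B\<close> as a convex combination,
  with weights \<open>a\<close> and \<open>1 - a\<close>, of two Banach limits. By extremality both equal \<open>B\<close>, and evaluating
  the first one at \<open>p\<close> gives the claim. If \<open>a\<close> is 0 or 1, the normalisation breaks down, but then
  \<open>2 p - 1 \<le> p\<^sup>2 \<le> p\<close> determines the value at \<open>p\<^sup>2\<close>.
\<close>

lemma extreme_banach_limit_mult_unit_interval:
  assumes extreme: "B extreme_point_of banach_limits"
    and p: "slowly_varying p" "\<And>i. 0 \<le> p i" "\<And>i. p i \<le> 1"
  shows "seq_apply B (\<lambda>i. p i * p i) = seq_apply B p * seq_apply B p"
proof -
  have B: "B \<in> banach_limits"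
    using extreme by (simp add: extreme_point_of_def)
  have bddp: "bounded (range p)"
    using p(1) by (simp add: slowly_varying_def)
  have bddpp: "bounded (range (\<lambda>i. p i * p i))"
    using bddp bddp by (rule bounded_range_mult)
  define q where "q = (\<lambda>i. 1 - p i)"
  have q: "slowly_varying q" "\<And>i. 0 \<le> q i"
    using p tendsto_minus[of "\<lambda>i. p (Suc i) - p i" 0 sequentially]
    by (auto simp: slowly_varying_def q_def intro!: bounded_minus_comp)
  have bddq: "bounded (range q)"
    using q(1) by (simp add: slowly_varying_def)
  define a where "a = seq_apply B p"
  have aq: "seq_apply B q = 1 - a"
    using B bddp by (simp add: q_def a_def seq_apply_diff seq_apply_const)
  have a: "0 \<le> a" "a \<le> 1"
    using seq_apply_nonneg[OF B bddp] seq_apply_nonneg[OF B bddq] p(2) q(2) aq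
    by (auto simp: a_def)
  have pp: "0 \<le> seq_apply B (\<lambda>i. p i * p i)" "seq_apply B (\<lambda>i. p i * p i) \<le> a"
    using p seq_apply_mono[OF B bddpp bddp] seq_apply_nonneg[OF B bddpp]
    by (auto simp: a_def mult_left_le)
  consider "a = 0" | "a = 1" | "0 < a" "a < 1"
    using a by linarith
  then have "seq_apply B (\<lambda>i. p i * p i) = a * a"
  proof cases
    case 1
    with pp show ?thesis by simp
  next
    case 2
    have "seq_apply B (\<lambda>i. 2 * p i - 1) \<le> seq_apply B (\<lambda>i. p i * p i)"
    proof (intro seq_apply_mono B bddpp bounded_minus_comp bounded_range_mult bddp)
      fix i
      show "2 * p i - 1 \<le> p i * p i"
        using zero_le_square[of "p i - 1"] by (simp add: algebra_simps)
    qed auto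
    moreover have "seq_apply B (\<lambda>i. 2 * p i - 1) = 2 * a - 1"
      using bddp B bounded_range_mult[OF _ bddp, of "\<lambda>_. 2"]
      by (simp add: seq_apply_diff seq_apply_cmult seq_apply_const a_def)
    ultimately show ?thesis
      using pp 2 by simp
  next
    case 3
    define P where "P = weighted B p /\<^sub>R a"
    define Q where "Q = weighted B q /\<^sub>R (1 - a)"
    have "P \<in> banach_limits" "Q \<in> banach_limits"
      using normalized_weighted_banach_limit[OF B p(1,2)] normalized_weighted_banach_limit[OF B q] 3 aq
      by (auto simp: P_def Q_def a_def)
    then have "B \<notin> open_segment P Q"
      using extreme by (auto simp: extreme_point_of_def)
    moreover have mix: "B = (1 - a) *\<^sub>R Q + a *\<^sub>R P"
    proof (rule blinfun_eqI)
      fix x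
      have bdd: "bounded (range (\<lambda>i. p i * apply_bcontfun x i))"
          "bounded (range (\<lambda>i. q i * apply_bcontfun x i))"
        by (intro bounded_range_mult bddp bddq bounded_range_apply_bcontfun)+
      have "blinfun_apply B x =
          seq_apply B (\<lambda>i. q i * apply_bcontfun x i + p i * apply_bcontfun x i)"
        by (simp add: q_def left_diff_distrib seq_apply_apply_bcontfun)
      also have "\<dots> = seq_apply B (\<lambda>i. q i * apply_bcontfun x i) + seq_apply B (\<lambda>i. p i * apply_bcontfun x i)"
        by (rule seq_apply_add[OF bdd(2,1)])
      finally show "blinfun_apply B x = blinfun_apply ((1 - a) *\<^sub>R Q + a *\<^sub>R P) x"
        using 3 by (simp add: P_def Q_def blinfun.add_left blinfun.scaleR_left
            blinfun_apply_weighted[OF bddp] blinfun_apply_weighted[OF bddq])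
    qed
    ultimately have "P = Q"
      using 3 by (auto simp: in_segment open_segment_commute[of P Q])
    with mix have "P = B"
      by (simp add: algebra_simps)
    then have "blinfun_apply P (Bcontfun p) = a"
      by (simp add: a_def seq_apply_def)
    then have "a * a = a * blinfun_apply P (Bcontfun p)"
      by simp
    also have "\<dots> = seq_apply B (\<lambda>i. p i * p i)"
      using 3 by (simp add: P_def blinfun.scaleR_left blinfun_apply_weighted[OF bddp] apply_Bcontfun[OF bddp])
    finally show ?thesis by simp
  qed
  then show ?thesis
    by (simp add: a_def)
qed

text \<open>
  An affine rescaling moves \<open>f\<close> into the unit interval, where \<open>B\<close> preserves squares; the variance is
  multiplied by a constant under rescaling.
\<close>

lemma extreme_banach_limit_variance_zero:
  assumes extreme: "B extreme_point_of banach_limits" and f: "slowly_varying f"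
  shows "seq_apply B (\<lambda>i. (f i - seq_apply B f)\<^sup>2) = 0"
proof -
  have B: "B \<in> banach_limits"
    using extreme by (simp add: extreme_point_of_def)
  have bddf: "bounded (range f)" and null: "(\<lambda>i. f (Suc i) - f i) \<longlonglongrightarrow> 0"
    using f by (auto simp: slowly_varying_def)
  obtain K where "\<And>i. \<bar>f i\<bar> \<le> K"
    using bddf by (auto simp: bounded_iff)
  define L where "L = 2 * (\<bar>K\<bar> + 1)"
  have "\<bar>f i\<bar> \<le> L / 2" for i
    using \<open>\<And>i. \<bar>f i\<bar> \<le> K\<close>[of i] by (simp add: L_def)
  then have L: "L > 0" "\<And>i. \<bar>f i\<bar> \<le> L / 2"
    by (auto simp: L_def)
  define p where "p = (\<lambda>i. (1 / L) * f i + 1 / 2)"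
  have bddp: "bounded (range p)"
    unfolding p_def by (intro bounded_plus_comp bounded_range_mult bddf) auto
  have "0 \<le> p i" "p i \<le> 1" for i
    using L(1) L(2)[of i] by (auto simp: p_def field_simps abs_le_iff)
  moreover have "slowly_varying p"
    using bddp tendsto_mult_left[OF null, of "1 / L"]
    by (simp add: slowly_varying_def p_def right_diff_distrib diff_divide_distrib)
  ultimately have mult: "seq_apply B (\<lambda>i. p i * p i) = seq_apply B p * seq_apply B p"
    using extreme_banach_limit_mult_unit_interval[OF extreme] by blast
  define a where "a = seq_apply B p"
  have a: "a = (1 / L) * seq_apply B f + 1 / 2"
    unfolding a_def p_def using bddf bounded_range_mult[OF _ bddf, of "\<lambda>_. 1 / L"] B
      seq_apply_cmult[OF bddf, of B "1 / L"]
    by (subst seq_apply_add) (auto simp: seq_apply_const)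
  have "(f i - seq_apply B f)\<^sup>2 = L\<^sup>2 * (p i * p i - 2 * a * p i + a\<^sup>2)" for i
  proof -
    have "f i - seq_apply B f = L * (p i - a)"
      using L(1) by (simp add: p_def a field_simps)
    then show ?thesis
      by (simp only: power_mult_distrib power2_diff) (simp add: power2_eq_square)
  qed
  moreover have "seq_apply B (\<lambda>i. p i * p i - 2 * a * p i + a\<^sup>2) = a * a - 2 * a * a + a\<^sup>2"
    using bounded_range_mult[OF bddp bddp] bounded_range_mult[OF _ bddp, of "\<lambda>_. 2 * a"] B mult
      seq_apply_cmult[OF bddp, of B "2 * a"] bddp
    by (simp add: seq_apply_add seq_apply_diff bounded_minus_comp seq_apply_const a_def)
  moreover have "bounded (range (\<lambda>i. p i * p i - 2 * a * p i + a\<^sup>2))"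
    by (intro bounded_plus_comp bounded_minus_comp bounded_range_mult bddp) auto
  ultimately show ?thesis
    by (simp add: seq_apply_cmult power2_eq_square)
qed

section \<open>Separation of functionals and the distance 2\<close>

text \<open>
  For positive functionals of mass one this is mutual singularity, that is, disjointness in the
  Banach lattice of functionals.
\<close>

definition separated_from :: "linf_dual \<Rightarrow> linf_dual \<Rightarrow> bool" where
  "separated_from A B \<longleftrightarrow> (\<forall>e>0. \<exists>f. (\<forall>i. 0 \<le> f i \<and> f i \<le> 1) \<and>
     seq_apply A f \<le> e \<and> 1 - e \<le> seq_apply B f)"

lemma bounded_range_unit_interval:
  fixes f :: "nat \<Rightarrow> real"
  shows "(\<And>i. 0 \<le> f i \<and> f i \<le> 1) \<Longrightarrow> bounded (range f)"
  by (auto simp: bounded_iff intro!: exI[of _ 1])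

lemma convex_separated_from:
  assumes A: "A \<in> banach_limits"
  shows "convex {B \<in> banach_limits. separated_from A B}"
proof (rule convexI)
  fix B C :: linf_dual and u v :: real
  assume "B \<in> {B \<in> banach_limits. separated_from A B}"
    and "C \<in> {B \<in> banach_limits. separated_from A B}"
    and uv: "0 \<le> u" "0 \<le> v" "u + v = 1"
  then have BC: "B \<in> banach_limits" "C \<in> banach_limits" "separated_from A B" "separated_from A C"
    by auto
  have "u *\<^sub>R B + v *\<^sub>R C \<in> banach_limits"
    using BC(1,2) uv by (auto simp: banach_limits_def blinfun.add_left blinfun.scaleR_left)
  moreover have "separated_from A (u *\<^sub>R B + v *\<^sub>R C)"
    unfolding separated_from_def
  proof (intro allI impI)
    fix e :: real
    assume "e > 0"
    then have "e / 2 > 0" by simp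
    then obtain f g where f: "\<And>i. 0 \<le> f i \<and> f i \<le> 1" "seq_apply A f \<le> e / 2" "1 - e / 2 \<le> seq_apply B f"
      and g: "\<And>i. 0 \<le> g i \<and> g i \<le> 1" "seq_apply A g \<le> e / 2" "1 - e / 2 \<le> seq_apply C g"
      using BC(3,4) unfolding separated_from_def by meson
    define h where "h = (\<lambda>i. max (f i) (g i))"
    have h: "\<And>i. 0 \<le> h i \<and> h i \<le> 1" "\<And>i. f i \<le> h i" "\<And>i. g i \<le> h i" "\<And>i. h i \<le> f i + g i"
      using f(1) g(1) by (auto simp: h_def max_def)
    note bdd = bounded_range_unit_interval[OF f(1)] bounded_range_unit_interval[OF g(1)]
      bounded_range_unit_interval[OF h(1)]
    have "seq_apply A h \<le> seq_apply A (\<lambda>i. f i + g i)"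
      by (intro seq_apply_mono A bdd bounded_plus_comp h)
    then have "seq_apply A h \<le> e"
      using f(2) g(2) by (simp add: seq_apply_add bdd)
    moreover have "1 - e \<le> seq_apply B h" "1 - e \<le> seq_apply C h"
      using seq_apply_mono[of B f h] seq_apply_mono[of C g h] BC(1,2) bdd h(2,3)
        f(3) g(3) \<open>e > 0\<close> by auto
    then have "u * (1 - e) + v * (1 - e) \<le> u * seq_apply B h + v * seq_apply C h"
      using uv by (intro add_mono mult_left_mono)
    then have "1 - e \<le> seq_apply (u *\<^sub>R B + v *\<^sub>R C) h"
      using uv(3) by (simp add: seq_apply_def blinfun.add_left blinfun.scaleR_left flip: distrib_right)
    ultimately show "\<exists>f. (\<forall>i. 0 \<le> f i \<and> f i \<le> 1) \<and>
        seq_apply A f \<le> e \<and> 1 - e \<le> seq_apply (u *\<^sub>R B + v *\<^sub>R C) f"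
      using h(1) by blast
  qed
  ultimately show "u *\<^sub>R B + v *\<^sub>R C \<in> {B \<in> banach_limits. separated_from A B}"
    by simp
qed

text \<open>
  If \<open>f\<close> separates, then \<open>1 - 2 f\<close> is a point of the unit ball where \<open>A\<close> is almost 1 and \<open>B\<close> is
  almost -1.
\<close>

lemma norm_diff_separated_from:
  assumes A: "A \<in> banach_limits" and B: "B \<in> banach_limits" and sep: "separated_from A B"
  shows "norm (A - B) = 2"
proof (rule antisym)
  show "norm (A - B) \<le> 2"
    using norm_triangle_ineq4[of A B] norm_banach_limit_le[OF A] norm_banach_limit_le[OF B] by simp
  show "2 \<le> norm (A - B)"
  proof (rule field_le_epsilon)
    fix e :: real
    assume "e > 0"
    then have "e / 4 > 0" by simp
    then obtain f where f: "\<And>i. 0 \<le> f i \<and> f i \<le> 1" "seq_apply A f \<le> e / 4" "1 - e / 4 \<le> seq_apply B f"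
      using sep unfolding separated_from_def by meson
    note bddf = bounded_range_unit_interval[OF f(1)]
    define h where "h = (\<lambda>i. 1 - 2 * f i)"
    have bdd2: "bounded (range (\<lambda>i. 2 * f i))"
      by (intro bounded_range_mult bddf) auto
    have bddh: "bounded (range h)"
      unfolding h_def by (intro bounded_minus_comp bdd2) auto
    have h: "seq_apply C h = 1 - 2 * seq_apply C f" if "C \<in> banach_limits" for C
      unfolding h_def using that bdd2 bddf by (simp add: seq_apply_diff seq_apply_cmult seq_apply_const)
    have norm_h: "norm (Bcontfun h) \<le> 1"
    proof (rule norm_bound)
      show "norm (apply_bcontfun (Bcontfun h) i) \<le> 1" for i
        using f(1)[of i] unfolding apply_Bcontfun[OF bddh] by (simp add: h_def abs_le_iff)
    qed
    have "2 - e \<le> seq_apply A h - seq_apply B h"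
      using f(2,3) by (simp add: h A B)
    also have "\<dots> \<le> norm (blinfun_apply (A - B) (Bcontfun h))"
      by (simp add: seq_apply_def blinfun.diff_left)
    also have "\<dots> \<le> norm (A - B) * norm (Bcontfun h)"
      by (rule norm_blinfun)
    also have "\<dots> \<le> norm (A - B)"
      using norm_h by (intro mult_left_le) auto
    finally show "2 \<le> norm (A - B) + e"
      by simp
  qed
qed

section \<open>Logarithmic rotation on the unit circle\<close>

text \<open>
  The points \<open>x i\<close> and \<open>y i\<close> need not converge; compactness of the disc supplies the uniform
  continuity that replaces convergence.
\<close>

lemma tendsto_null_uniformly_continuous:
  fixes x y :: "nat \<Rightarrow> complex" and \<phi> :: "complex \<Rightarrow> real"
  assumes "continuous_on (cball 0 1) \<phi>" "\<And>i. norm (x i) \<le> 1" "\<And>i. norm (y i) \<le> 1"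
    and "(\<lambda>i. x i - y i) \<longlonglongrightarrow> 0"
  shows "(\<lambda>i. \<phi> (x i) - \<phi> (y i)) \<longlonglongrightarrow> 0"
proof -
  have "uniformly_continuous_on (cball 0 1) \<phi>"
    using assms(1) by (rule compact_uniformly_continuous) simp
  moreover have "(\<lambda>i. dist (x i) (y i)) \<longlonglongrightarrow> 0"
    using tendsto_norm_zero[OF assms(4)] by (simp add: dist_norm)
  ultimately have "(\<lambda>i. dist (\<phi> (x i)) (\<phi> (y i))) \<longlonglongrightarrow> 0"
    using assms(2,3) unfolding uniformly_continuous_on_sequentially by simp
  then show ?thesis
    by (auto simp: dist_norm intro: tendsto_norm_zero_cancel)
qed

definition log_rotation :: "real \<Rightarrow> nat \<Rightarrow> complex" where
  "log_rotation \<theta> i = cis (\<theta> * ln (real i + 1))"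

lemma norm_log_rotation [simp]: "norm (log_rotation \<theta> i) = 1"
  by (simp add: log_rotation_def)

text \<open>
  The logarithm turns an asymptotic ratio \<open>c\<close> of indices into a rotation by the angle \<open>\<theta> ln c\<close>. Both
  slow variation (\<open>c = 1\<close>) and the behaviour under dilation (\<open>c = 1 / n\<close>) are instances.
\<close>

lemma log_rotation_asymptotic:
  fixes x y :: "nat \<Rightarrow> nat"
  assumes "c > 0" and "(\<lambda>i. (real (x i) + 1) / (real (y i) + 1)) \<longlonglongrightarrow> c"
  shows "(\<lambda>i. log_rotation \<theta> (x i) - cis (\<theta> * ln c) * log_rotation \<theta> (y i)) \<longlonglongrightarrow> 0"
proof -
  define r where "r = (\<lambda>i. cis (\<theta> * ln ((real (x i) + 1) / (real (y i) + 1))))"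
  have "r \<longlonglongrightarrow> cis (\<theta> * ln c)"
    unfolding r_def using assms by (intro tendsto_intros) auto
  then have "(\<lambda>i. r i - cis (\<theta> * ln c)) \<longlonglongrightarrow> 0"
    by (rule LIM_zero)
  moreover have "r i * log_rotation \<theta> (y i) = log_rotation \<theta> (x i)" for i
    by (simp add: r_def log_rotation_def cis_mult ln_div algebra_simps)
  then have "norm (r i - cis (\<theta> * ln c)) =
      norm (log_rotation \<theta> (x i) - cis (\<theta> * ln c) * log_rotation \<theta> (y i))" for i
    by (metis left_diff_distrib mult.right_neutral norm_log_rotation norm_mult)
  ultimately have "(\<lambda>i. norm (log_rotation \<theta> (x i) - cis (\<theta> * ln c) * log_rotation \<theta> (y i))) \<longlonglongrightarrow> 0"
    using tendsto_norm_zero[of "\<lambda>i. r i - cis (\<theta> * ln c)" sequentially] by simp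
  then show ?thesis
    by (rule tendsto_norm_zero_cancel)
qed

lemma log_rotation_Suc: "(\<lambda>i. log_rotation \<theta> (Suc i) - log_rotation \<theta> i) \<longlonglongrightarrow> 0"
proof -
  have "(\<lambda>i. 1 + inverse (real (Suc i))) \<longlonglongrightarrow> 1 + 0"
    by (intro tendsto_intros LIMSEQ_inverse_real_of_nat)
  moreover have "1 + inverse (real (Suc i)) = (real (Suc i) + 1) / (real i + 1)" for i
    by (simp add: field_simps)
  ultimately show ?thesis
    using log_rotation_asymptotic[of 1 Suc "\<lambda>i. i" \<theta>] by simp
qed

lemma log_rotation_div:
  assumes "n > 0"
  shows "(\<lambda>i. log_rotation \<theta> (i div n) - cis (- (\<theta> * ln (real n))) * log_rotation \<theta> i) \<longlonglongrightarrow> 0"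
proof -
  have "(\<lambda>i. (real (i div n) + 1) / (real i + 1)) \<longlonglongrightarrow> 1 / real n"
  proof (rule real_tendsto_sandwich)
    have bounds_below: "real i + 1 \<le> real n * (real (i div n) + 1)" for i
    proof -
      have "i + 1 \<le> n * (i div n + 1)"
        using dividend_less_times_div[OF assms, of i] unfolding distrib_left by linarith
      then have "real (i + 1) \<le> real (n * (i div n + 1))"
        by (rule of_nat_mono)
      then show ?thesis
        by (simp only: of_nat_mult of_nat_add of_nat_1)
    qed
    have bounds_above: "real n * real (i div n) \<le> real i + 1" for i
    proof -
      have "n * (i div n) \<le> i + 1"
        using times_div_less_eq_dividend[of n i] by linarith
      then have "real (n * (i div n)) \<le> real (i + 1)"
        by (rule of_nat_mono)
      then show ?thesis
        by (simp only: of_nat_mult of_nat_add of_nat_1)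
    qed
    have "1 / real n \<le> (real (i div n) + 1) / (real i + 1)" for i
      using bounds_below[of i] assms by (simp add: divide_le_eq le_divide_eq mult.commute)
    then show "\<forall>\<^sub>F i in sequentially. 1 / real n \<le> (real (i div n) + 1) / (real i + 1)"
      by (intro always_eventually allI)
    have "real (i div n) / (real i + 1) \<le> 1 / real n" for i
      using bounds_above[of i] assms by (simp add: divide_le_eq le_divide_eq mult.commute)
    then have "(real (i div n) + 1) / (real i + 1) \<le> 1 / real n + inverse (real (Suc i))" for i
      by (simp add: add_divide_distrib inverse_eq_divide add.commute)
    then show "\<forall>\<^sub>F i in sequentially. (real (i div n) + 1) / (real i + 1) \<le> 1 / real n + inverse (real (Suc i))"
      by (intro always_eventually allI)
    show "(\<lambda>i. 1 / real n + inverse (real (Suc i))) \<longlonglongrightarrow> 1 / real n"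
      using tendsto_add[OF tendsto_const LIMSEQ_inverse_real_of_nat, of "1 / real n"] by simp
  qed simp
  then show ?thesis
    using log_rotation_asymptotic[of "1 / real n" "\<lambda>i. i div n" "\<lambda>i. i" \<theta>] assms by (simp add: ln_div)
qed

text \<open>
  The real and the imaginary part of the points vary slowly, so both have variance zero around
  their mean values under \<open>B\<close>; these are the coordinates of \<open>w\<close>.
\<close>

lemma extreme_banach_limit_concentrated:
  assumes extreme: "B extreme_point_of banach_limits"
  obtains w where "seq_apply B (\<lambda>i. (norm (log_rotation \<theta> i - w))\<^sup>2) = 0"
proof -
  have sv: "slowly_varying (\<lambda>i. \<phi> (log_rotation \<theta> i))"
    if "continuous_on (cball 0 1) \<phi>" "\<And>z. \<bar>\<phi> z\<bar> \<le> norm z" for \<phi> :: "complex \<Rightarrow> real"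
  proof -
    have "\<bar>\<phi> (log_rotation \<theta> i)\<bar> \<le> 1" for i
      using that(2)[of "log_rotation \<theta> i"] by simp
    then show ?thesis
      unfolding slowly_varying_def
      by (auto simp: bounded_iff intro!: tendsto_null_uniformly_continuous that log_rotation_Suc)
  qed
  define f where "f = (\<lambda>i. Re (log_rotation \<theta> i))"
  define g where "g = (\<lambda>i. Im (log_rotation \<theta> i))"
  have fg: "slowly_varying f" "slowly_varying g"
    unfolding f_def g_def
    by (auto intro!: sv continuous_intros abs_Re_le_cmod abs_Im_le_cmod)
  define u v where "u = seq_apply B f" and "v = seq_apply B g"
  have bdd: "bounded (range (\<lambda>i. (f i - u)\<^sup>2))" "bounded (range (\<lambda>i. (g i - v)\<^sup>2))"
    using fg unfolding power2_eq_square slowly_varying_def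
    by (auto intro!: bounded_range_mult bounded_minus_comp)
  have sq: "(norm (log_rotation \<theta> i - Complex u v))\<^sup>2 = (f i - u)\<^sup>2 + (g i - v)\<^sup>2" for i
    by (simp add: cmod_power2 f_def g_def)
  have "seq_apply B (\<lambda>i. (norm (log_rotation \<theta> i - Complex u v))\<^sup>2) = 0"
    using fg[THEN extreme_banach_limit_variance_zero[OF extreme]] seq_apply_add[OF bdd]
    by (simp add: sq flip: u_def v_def)
  then show thesis
    by (rule that)
qed

section \<open>Separating dilation-invariant from extreme Banach limits\<close>

lemma inj_on_roots_of_unity:
  assumes "N > 0"
  shows "inj_on (\<lambda>k. cis (2 * pi / real N) ^ k) {..<N}"
proof -
  have "cis (2 * pi / real N) ^ k = cis (2 * pi * real k / real N)" for k
    unfolding Complex.DeMoivre by (simp add: field_simps)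
  then show ?thesis
    using bij_betw_imp_inj_on[OF Complex.bij_betw_roots_unity[OF assms]] by simp
qed

lemma separated_finite_inj_on:
  fixes f :: "'a \<Rightarrow> 'b :: metric_space"
  assumes "finite A" "inj_on f A"
  obtains \<delta> where "\<delta> > 0" "\<And>k l. k \<in> A \<Longrightarrow> l \<in> A \<Longrightarrow> k \<noteq> l \<Longrightarrow> \<delta> \<le> dist (f k) (f l)"
proof -
  define D where "D = insert 1 ((\<lambda>(k, l). dist (f k) (f l)) ` {(k, l) \<in> A \<times> A. k \<noteq> l})"
  have "finite {(k, l) \<in> A \<times> A. k \<noteq> l}"
    using assms(1) by (auto intro: finite_subset[of _ "A \<times> A"])
  then have fin: "finite D" "D \<noteq> {}"
    by (auto simp: D_def)
  have "Min D > 0"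
    using fin assms(2) by (auto simp: D_def inj_on_def)
  moreover have "Min D \<le> dist (f k) (f l)" if "k \<in> A" "l \<in> A" "k \<noteq> l" for k l
    using fin that by (intro Min_le) (auto simp: D_def)
  ultimately show thesis
    by (rule that)
qed

lemma sum_le_if_at_most_one_nonzero:
  fixes f :: "'a \<Rightarrow> real"
  assumes "finite A" "0 \<le> c" "\<And>k. k \<in> A \<Longrightarrow> f k \<le> c"
    and "\<And>k l. k \<in> A \<Longrightarrow> l \<in> A \<Longrightarrow> f k \<noteq> 0 \<Longrightarrow> f l \<noteq> 0 \<Longrightarrow> k = l"
  shows "sum f A \<le> c"
proof (cases "\<exists>k\<in>A. f k \<noteq> 0")
  case True
  then obtain k where k: "k \<in> A" "f k \<noteq> 0" by blast
  then have "sum f A = sum f {k}"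
    using assms(1,4) by (intro sum.mono_neutral_right) auto
  then show ?thesis
    using assms(3) k by simp
next
  case False
  then show ?thesis
    using assms(2) by simp
qed

text \<open>
  The separating sequence is a bump function around \<open>w\<close>, evaluated at the points of the logarithmic
  rotation. It is so narrow that its \<open>N\<close> rotated copies have disjoint supports; \<open>A\<close> takes the same
  value on all copies, and their sum is at most 1.
\<close>

lemma dilation_invariant_separated_from_extreme:
  assumes n: "n \<ge> 2" and A: "A \<in> dilation_invariant_banach_limits n"
    and extreme: "B extreme_point_of banach_limits"
  shows "separated_from A B"
  unfolding separated_from_def
proof (intro allI impI)
  fix e :: real
  assume "e > 0"
  obtain N :: nat where N: "N > 0" "1 / real N < e"
    using reals_Archimedean[OF \<open>e > 0\<close>] by (metis inverse_eq_divide zero_less_Suc)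
  have A': "A \<in> banach_limits"
    using A by (simp add: dilation_invariant_banach_limits_def)
  have B: "B \<in> banach_limits"
    using extreme by (simp add: extreme_point_of_def)
  \<comment> \<open>With this speed, dilation by \<open>n\<close> rotates the points by exactly an \<open>N\<close>-th of the full circle.\<close>
  define \<theta> where "\<theta> = - (2 * pi / real N) / ln (real n)"
  define \<omega> where "\<omega> = cis (2 * pi / real N)"
  have \<omega>: "\<omega> = cis (- (\<theta> * ln (real n)))"
    using n by (simp add: \<theta>_def \<omega>_def)
  have norm_\<omega> [simp]: "norm \<omega> = 1"
    by (simp add: \<omega>_def)
  obtain w where w: "seq_apply B (\<lambda>i. (norm (log_rotation \<theta> i - w))\<^sup>2) = 0"
    using extreme_banach_limit_concentrated[OF extreme] by blast
  obtain \<delta> where \<delta>: "\<delta> > 0" "\<And>k l. k < N \<Longrightarrow> l < N \<Longrightarrow> k \<noteq> l \<Longrightarrow> \<delta> \<le> dist (\<omega> ^ k) (\<omega> ^ l)"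
    using separated_finite_inj_on[OF _ inj_on_roots_of_unity[OF N(1)]] unfolding \<omega>_def
    by (metis finite_lessThan lessThan_iff)
  \<comment> \<open>The bump vanishes at distance \<open>\<delta> / 2\<close> from \<open>w\<close>, half the distance between different powers
    of \<open>\<omega>\<close>. Its profile is quadratic because the second moment around \<open>w\<close> is what \<open>B\<close> controls.\<close>
  define c where "c = 1 / (\<delta> / 2)\<^sup>2"
  define \<phi> where "\<phi> = (\<lambda>z. max 0 (1 - c * (norm (z - w))\<^sup>2))"
  have \<phi>_cont: "continuous_on (cball 0 1) \<phi>"
    unfolding \<phi>_def by (intro continuous_intros)
  have \<phi>_unit: "0 \<le> \<phi> z \<and> \<phi> z \<le> 1" for z
    by (simp add: \<phi>_def c_def)
  have \<phi>_support: "dist z w < \<delta> / 2" if "\<phi> z \<noteq> 0" for z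
  proof -
    have "(norm (z - w))\<^sup>2 < (\<delta> / 2)\<^sup>2"
      using that \<delta>(1) by (auto simp: \<phi>_def c_def max_def field_simps split: if_splits)
    then show ?thesis
      unfolding dist_norm by (rule power2_less_imp_less) (use \<delta>(1) in simp)
  qed
  define b where "b = (\<lambda>k i. \<phi> (\<omega> ^ k * log_rotation \<theta> i))"
  have bdd: "bounded (range (b k))" for k
    unfolding b_def by (rule bounded_range_unit_interval) (rule \<phi>_unit)
  have b_Suc: "seq_apply A (b (Suc k)) = seq_apply A (b k)" for k
  proof -
    have "(\<lambda>i. \<omega> ^ k * (log_rotation \<theta> (i div n) - \<omega> * log_rotation \<theta> i)) \<longlonglongrightarrow> 0"
      using log_rotation_div[of n \<theta>] n unfolding \<omega>[symmetric] by (intro tendsto_mult_right_zero) auto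
    then have "(\<lambda>i. \<omega> ^ k * log_rotation \<theta> (i div n) - \<omega> ^ Suc k * log_rotation \<theta> i) \<longlonglongrightarrow> 0"
      by (simp add: algebra_simps)
    then have "(\<lambda>i. b k (i div n) - b (Suc k) i) \<longlonglongrightarrow> 0"
      unfolding b_def
      by (intro tendsto_null_uniformly_continuous \<phi>_cont) (auto simp: norm_mult norm_power)
    moreover have "bounded (range (\<lambda>i. b k (i div n)))"
      using bdd[of k] by (rule bounded_subset) auto
    ultimately have "seq_apply A (\<lambda>i. b k (i div n)) = seq_apply A (b (Suc k))"
      by (intro seq_apply_cong_null A' bdd)
    then show ?thesis
      by (simp add: seq_apply_dilation[OF A bdd])
  qed
  have b_eq: "seq_apply A (b k) = seq_apply A (b 0)" for k
    by (induction k) (simp_all add: b_Suc)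
  have "real N * seq_apply A (b 0) = (\<Sum>k<N. seq_apply A (b 0))"
    by simp
  also have "\<dots> = (\<Sum>k<N. seq_apply A (b k))"
    by (intro sum.cong refl b_eq[symmetric])
  also have "\<dots> = seq_apply A (\<lambda>i. \<Sum>k<N. b k i)"
    by (simp add: seq_apply_sum bdd)
  also have "\<dots> \<le> seq_apply A (\<lambda>_. 1)"
  proof (intro seq_apply_mono A' bounded_range_sum bdd)
    fix i
    show "(\<Sum>k<N. b k i) \<le> 1"
    proof (rule sum_le_if_at_most_one_nonzero)
      fix k l
      assume "k \<in> {..<N}" "l \<in> {..<N}" "b k i \<noteq> 0" "b l i \<noteq> 0"
      then have "dist (\<omega> ^ k * log_rotation \<theta> i) w < \<delta> / 2" "dist (\<omega> ^ l * log_rotation \<theta> i) w < \<delta> / 2"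
        by (auto simp: b_def dest: \<phi>_support)
      then have "dist (\<omega> ^ k * log_rotation \<theta> i) (\<omega> ^ l * log_rotation \<theta> i) < \<delta>"
        by (rule dist_triangle_half_l)
      then have "dist (\<omega> ^ k) (\<omega> ^ l) < \<delta>"
        by (simp add: dist_norm norm_mult flip: left_diff_distrib)
      then show "k = l"
        using \<delta>(2)[of k l] \<open>k \<in> _\<close> \<open>l \<in> _\<close> by force
    qed (auto simp: b_def \<phi>_unit)
  qed auto
  finally have "seq_apply A (b 0) \<le> 1 / real N"
    using N(1) by (simp add: seq_apply_const[OF A'] field_simps)
  then have "seq_apply A (b 0) \<le> e"
    using N(2) by simp
  moreover have "1 - e \<le> seq_apply B (b 0)"
  proof -
    have bddw: "bounded (range (\<lambda>i. (norm (log_rotation \<theta> i - w))\<^sup>2))"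
    proof -
      have "norm (log_rotation \<theta> i - w) \<le> 1 + norm w" for i
        using norm_triangle_ineq4[of "log_rotation \<theta> i" w] by simp
      then have "bounded (range (\<lambda>i. norm (log_rotation \<theta> i - w)))"
        by (auto simp: bounded_iff)
      then show ?thesis
        unfolding power2_eq_square by (intro bounded_range_mult)
    qed
    then have bddcw: "bounded (range (\<lambda>i. c * (norm (log_rotation \<theta> i - w))\<^sup>2))"
      by (intro bounded_range_mult) auto
    have "seq_apply B (\<lambda>i. 1 - c * (norm (log_rotation \<theta> i - w))\<^sup>2) \<le> seq_apply B (b 0)"
      by (intro seq_apply_mono B bdd bounded_minus_comp bddcw) (auto simp: b_def \<phi>_def)
    then show ?thesis
      using \<open>e > 0\<close> by (simp add: seq_apply_diff bddcw seq_apply_const[OF B] seq_apply_cmult[OF bddw] w)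
  qed
  ultimately show "\<exists>f. (\<forall>i. 0 \<le> f i \<and> f i \<le> 1) \<and> seq_apply A f \<le> e \<and> 1 - e \<le> seq_apply B f"
    using \<phi>_unit by (intro exI[of _ "b 0"]) (simp add: b_def)
qed

theorem corollary6:
  fixes n :: nat and B\<^sub>1 B\<^sub>2 :: linf_dual
  assumes "n \<ge> 2"
    and "B\<^sub>1 \<in> dilation_invariant_banach_limits n"
    and "B\<^sub>2 \<in> closure (convex hull {B. B extreme_point_of banach_limits})"
  shows "norm (B\<^sub>1 - B\<^sub>2) = 2"
proof -
  have B\<^sub>1: "B\<^sub>1 \<in> banach_limits"
    using assms(2) by (simp add: dilation_invariant_banach_limits_def)
  have "convex hull {B. B extreme_point_of banach_limits} \<subseteq> {B \<in> banach_limits. separated_from B\<^sub>1 B}"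
    using dilation_invariant_separated_from_extreme[OF assms(1,2)]
    by (intro hull_minimal convex_separated_from B\<^sub>1) (auto simp: extreme_point_of_def)
  also have "\<dots> \<subseteq> {B. norm (B\<^sub>1 - B) = 2}"
    using norm_diff_separated_from[OF B\<^sub>1] by blast
  finally have "closure (convex hull {B. B extreme_point_of banach_limits}) \<subseteq> {B. norm (B\<^sub>1 - B) = 2}"
    by (intro closure_minimal closed_Collect_eq continuous_intros)
  then show ?thesis
    using assms(3) by blast
qed

end
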